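(* Let $A,B\subseteq\mathbb{N}$. If $A\leq_{fe}B\leq_{fe}A+1$, then $A\equiv_{fe}B$ or $A+1\equiv_{fe}B$.
   Context: $\mathbb{N}=\{0,1,2,\dots\}$, $A+1=\{a+1\mid a\in A\}$. For $A,B\subseteq\mathbb{N}$, $A\leq_{fe}B$ means that for every finite $F\subseteq A$ there is $k\in\mathbb{N}$ with $F+k\subseteq B$; $A\equiv_{fe}B$ means $A\leq_{fe}B$ and $B\leq_{fe}A$. *)

theory Defs
  imports Main
begin

definition shift :: "nat set \<Rightarrow> nat \<Rightarrow> nat set"
  where "shift A k = (\<lambda>a. a + k) ` A"

definition fe_le :: "nat set \<Rightarrow> nat set \<Rightarrow> bool"  (infix "\<le>\<^sub>f\<^sub>e" 50)
  where "A \<le>\<^sub>f\<^sub>e B \<longleftrightarrow> (\<forall>F. finite F \<and> F \<subseteq> A \<longrightarrow> (\<exists>k. shift F k \<subseteq> B))"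

definition fe_equiv :: "nat set \<Rightarrow> nat set \<Rightarrow> bool"  (infix "\<equiv>\<^sub>f\<^sub>e" 50)
  where "A \<equiv>\<^sub>f\<^sub>e B \<longleftrightarrow> A \<le>\<^sub>f\<^sub>e B \<and> B \<le>\<^sub>f\<^sub>e A"

end

theory Submission
  imports Defs
begin

text \<open>If \<open>A + 1 \<le> B\<close> fails, some finite \<open>F \<subseteq> A\<close> has no translate by a positive number in \<open>B\<close>.
  Adjoining \<open>F\<close> to the finite sets tested by \<open>A \<le> B\<close> forces the translations to be trivial, so
  \<open>A \<subseteq> B\<close>. Likewise \<open>B \<subseteq> A + 1\<close> if \<open>B \<le> A\<close> fails. If both fail, \<open>A \<subseteq> A + 1\<close>, so \<open>A\<close> has no
  least element and is empty.\<close>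

lemma fe_le_cases:
  assumes "A \<le>\<^sub>f\<^sub>e B"
  shows "A \<subseteq> B \<or> shift A 1 \<le>\<^sub>f\<^sub>e B"
proof (rule disjCI)
  assume "\<not> shift A 1 \<le>\<^sub>f\<^sub>e B"
  then obtain F' where F': "finite F'" "F' \<subseteq> shift A 1" and no': "\<And>k. \<not> shift F' k \<subseteq> B"
    by (auto simp: fe_le_def)
  then obtain F where F: "finite F" "F \<subseteq> A" "F' = shift F 1"
    unfolding shift_def by (meson finite_subset_image)
  show "A \<subseteq> B"
  proof
    fix a assume "a \<in> A"
    \<comment> \<open>One \<open>k\<close> has to serve both \<open>a\<close> and \<open>F\<close>,
      so the obstruction \<open>F\<close> also constrains the translate of \<open>a\<close>.\<close>
    then obtain k where k: "shift (insert a F) k \<subseteq> B"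
      using assms F unfolding fe_le_def by (meson finite_insert insert_subset)
    have "k = 0"
    proof (cases k)
      case (Suc n)
      \<comment> \<open>Since \<open>F'\<close> is \<open>F\<close> moved by 1, moving
        \<open>F\<close> by \<open>Suc n\<close> is moving \<open>F'\<close> by
        \<open>n\<close>.\<close>
      then have "shift F' n \<subseteq> B"
        using k by (auto simp: F(3) shift_def)
      with no' show ?thesis by blast
    qed
    with k show "a \<in> B" by (simp add: shift_def)
  qed
qed

text \<open>Translations commute and \<open>Suc\<close> is injective, so the same \<open>k\<close>
  works on both sides. This turns the second case of \<open>fe_le_cases\<close> for \<open>B\<close>
  and \<open>shift A 1\<close> into \<open>B \<le>\<^sub>f\<^sub>e A\<close>.\<close>

lemma shift_one_fe_le_shift_one_iff: "shift B 1 \<le>\<^sub>f\<^sub>e shift A 1 \<longleftrightarrow> B \<le>\<^sub>f\<^sub>e A"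
proof -
  have "shift (shift F 1) k \<subseteq> shift A 1 \<longleftrightarrow> shift F k \<subseteq> A" for F k
  proof -
    have "shift (shift F 1) k = Suc ` shift F k"
      by (simp add: shift_def image_image)
    moreover have "shift A 1 = Suc ` A"
      by (simp add: shift_def)
    ultimately show ?thesis
      by (simp add: inj_image_subset_iff)
  qed
  then show ?thesis
    unfolding fe_le_def
    by (smt (verit) finite_imageI finite_subset_image image_mono shift_def)
qed

theorem theorem5:
  fixes A B :: "nat set"
  assumes "A \<le>\<^sub>f\<^sub>e B" and "B \<le>\<^sub>f\<^sub>e shift A 1"
  shows "A \<equiv>\<^sub>f\<^sub>e B \<or> shift A 1 \<equiv>\<^sub>f\<^sub>e B"
proof (rule ccontr)
  assume "\<not> ?thesis"
  then have nBA: "\<not> B \<le>\<^sub>f\<^sub>e A" and nAB: "\<not> shift A 1 \<le>\<^sub>f\<^sub>e B"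
    using assms by (auto simp: fe_equiv_def)
  have "A \<subseteq> B"
    using fe_le_cases[OF assms(1)] nAB by blast
  moreover have "B \<subseteq> shift A 1"
    using fe_le_cases[OF assms(2)] nBA shift_one_fe_le_shift_one_iff by blast
  ultimately have sub: "A \<subseteq> shift A 1" by blast
  have "n \<notin> A" for n
    by (induction n) (use sub in \<open>auto simp: shift_def\<close>)
  then have "A = {}" by blast
  \<comment> \<open>The empty set embeds in every set, against \<open>nAB\<close>.\<close>
  with nAB show False by (simp add: fe_le_def shift_def)
qed

end
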